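(* Let $k\geqslant 2$ be an integer. Then, as $n\to\infty$, $$\tilde{R}_k(n)=\frac{k^2}{k^2+k+1}\,n+O\big((\log_k n)^2\big).$$
   Context: A set $A\subset\{1,\dots,n\}$ is $k$-free if $x\neq ky$ for all $x,y\in A$. $\tilde{R}_k(n)$ denotes the minimal cardinality of a $k$-free set $A\subset\{1,\dots,n\}$ which is maximal for inclusion among $k$-free subsets of $\{1,\dots,n\}$. *)

theory Defs
  imports Complex_Main "HOL-Library.Landau_Symbols"
begin

definition k_free :: "nat \<Rightarrow> nat set \<Rightarrow> bool" where
  "k_free k A \<longleftrightarrow> (\<forall>x\<in>A. \<forall>y\<in>A. x \<noteq> k * y)"

definition maximal_k_free :: "nat \<Rightarrow> nat \<Rightarrow> nat set \<Rightarrow> bool" where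
  "maximal_k_free k n A \<longleftrightarrow>
     A \<subseteq> {1..n} \<and> k_free k A \<and>
     (\<forall>B. B \<subseteq> {1..n} \<and> k_free k B \<and> A \<subseteq> B \<longrightarrow> B = A)"

definition R_tilde :: "nat \<Rightarrow> nat \<Rightarrow> nat" where
  "R_tilde k n = Min (card ` {A. maximal_k_free k n A})"

text \<open>The set in the definition of \<open>R_tilde\<close> is finite and nonempty, so that \<open>Min\<close> is
  a genuine minimum.\<close>

lemma finite_maximal_k_free: "finite {A. maximal_k_free k n A}"
  by (rule finite_subset[of _ "Pow {1..n}"]) (auto simp: maximal_k_free_def)

lemma ex_maximal_k_free: "\<exists>A. maximal_k_free k n A"
proof -
  let ?F = "{A. A \<subseteq> {1..n} \<and> k_free k A}"
  have "finite ?F"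
    by (rule finite_subset[of _ "Pow {1..n}"]) auto
  moreover have "{} \<in> ?F"
    by (simp add: k_free_def)
  ultimately obtain A where "A \<in> ?F" "\<forall>B\<in>?F. A \<subseteq> B \<longrightarrow> A = B"
    using finite_has_maximal[of ?F] by blast
  then show ?thesis
    unfolding maximal_k_free_def by blast
qed

end

theory Submission
  imports Defs "HOL-Computational_Algebra.Primes"
begin

text \<open>The graph on \<open>{1..n}\<close> joining \<open>x\<close> to \<open>k * x\<close> is a disjoint union of paths, and a maximal
  \<open>k\<close>-free set is a maximal independent set of it. On each path, the vertices whose height
  \<open>multiplicity k x\<close> is divisible by \<open>3\<close> have disjoint closed neighbourhoods, each of which meets
  every maximal independent set; conversely these vertices, moved up by one step on the paths whose
  length is divisible by \<open>3\<close>, form a maximal independent set. Hence \<open>R_tilde k n\<close> counts the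
  \<open>x \<le> n\<close> of height divisible by \<open>3\<close>. This count \<open>s\<close> satisfies
  \<open>s n = n - n div k + s (n div k ^ 3)\<close>, so it differs from the solution
  \<open>k\<^sup>2 / (k\<^sup>2 + k + 1) * n\<close> of the recurrence without rounding by a bounded amount
  for each of its \<open>O (log n)\<close> steps.\<close>

section \<open>Maximality as domination\<close>

lemma maximal_k_free_iff_dominating:
  assumes "k \<ge> 2"
  shows "maximal_k_free k n A \<longleftrightarrow> A \<subseteq> {1..n} \<and> k_free k A \<and>
    (\<forall>x\<in>{1..n}. x \<in> A \<or> k * x \<in> A \<or> (\<exists>y\<in>A. x = k * y))" (is "_ \<longleftrightarrow> ?R")
proof
  assume A: "maximal_k_free k n A"
  have "x \<in> A \<or> k * x \<in> A \<or> (\<exists>y\<in>A. x = k * y)" if x: "x \<in> {1..n}" for x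
  proof (rule ccontr)
    assume c: "\<not> ?thesis"
    \<comment> \<open>The graph has no loops because \<open>k \<ge> 2\<close>, so a vertex with no
      neighbour in \<open>A\<close> can be added to it.\<close>
    have "x \<noteq> k * x" using x assms by auto
    then have "k_free k (insert x A)"
      using A c unfolding maximal_k_free_def k_free_def by auto
    moreover have "insert x A \<subseteq> {1..n}"
      using A x unfolding maximal_k_free_def by auto
    ultimately have "insert x A = A"
      using A unfolding maximal_k_free_def by blast
    then show False using c by blast
  qed
  then show ?R using A unfolding maximal_k_free_def by blast
next
  assume R: ?R
  have "B = A" if B: "B \<subseteq> {1..n}" "k_free k B" "A \<subseteq> B" for B
    using R B unfolding k_free_def by blast
  then show "maximal_k_free k n A"
    using R unfolding maximal_k_free_def by blast
qed

section \<open>Lower bound: disjoint closed neighbourhoods\<close>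

definition third_levels :: "nat \<Rightarrow> nat \<Rightarrow> nat set" where
  "third_levels k n = {x\<in>{1..n}. 3 dvd multiplicity k x}"

lemma finite_third_levels [simp]: "finite (third_levels k n)"
  by (simp add: third_levels_def)

text \<open>For composite \<open>k\<close> too, \<open>multiplicity\<close> gives the largest
  exponent of a power of \<open>k\<close> dividing the number, so it serves as the position on the
  path, counted from the bottom.\<close>

lemma multiplicity_mult_base:
  fixes k x :: nat
  assumes "k \<ge> 2" "x \<ge> 1"
  shows "multiplicity k (k * x) = Suc (multiplicity k x)"
  using assms by (intro multiplicity_times_same) auto

lemma card_third_levels_le:
  assumes k: "k \<ge> 2" and A: "maximal_k_free k n A"
  shows "card (third_levels k n) \<le> card A"
proof -
  have A1: "A \<subseteq> {1..n}"
    using A by (simp add: maximal_k_free_def)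
  have "\<exists>a\<in>A. a = x \<or> a = k * x \<or> x = k * a" if "x \<in> third_levels k n" for x
    using that A unfolding maximal_k_free_iff_dominating[OF k] third_levels_def by blast
  then obtain f where f: "\<And>x. x \<in> third_levels k n \<Longrightarrow>
      f x \<in> A \<and> (f x = x \<or> f x = k * x \<or> x = k * f x)"
    by metis
  \<comment> \<open>\<open>h\<close> recovers the centre of the neighbourhood from the height of
    \<open>z\<close> modulo 3: residue 0 is the centre itself, residue 2 lies just below it, residue
    1 just above.\<close>
  define h where "h z = (if 3 dvd multiplicity k z then z
    else if 3 dvd Suc (multiplicity k z) then k * z else z div k)" for z
  have "inj_on f (third_levels k n)"
  proof (rule inj_on_inverseI[where g = h])
    fix x assume x: "x \<in> third_levels k n"
    define z where "z = f x"
    have z: "z \<ge> 1" "z = x \<or> z = k * x \<or> x = k * z"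
      using f[OF x] A1 unfolding z_def by (metis atLeastAtMost_iff subsetD, metis)
    have x1: "x \<ge> 1" "3 dvd multiplicity k x"
      using x by (auto simp: third_levels_def)
    have no_dvd: "\<not> 3 dvd Suc a" "\<not> 3 dvd Suc (Suc a)" if "3 dvd a" for a :: nat
      using that by presburger+
    from z(2) have "h z = x"
    proof (elim disjE)
      assume "z = x"
      then show ?thesis using x1 by (simp add: h_def)
    next
      assume eq: "z = k * x"
      show ?thesis
        unfolding h_def eq multiplicity_mult_base[OF k x1(1)] using no_dvd[OF x1(2)] k by simp
    next
      assume eq: "x = k * z"
      have "3 dvd Suc (multiplicity k z)"
        using x1(2) unfolding eq multiplicity_mult_base[OF k z(1)] .
      moreover from this have "\<not> 3 dvd multiplicity k z"
        using no_dvd(1) by blast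
      ultimately show ?thesis
        unfolding h_def by (simp flip: eq)
    qed
    then show "h (f x) = x"
      by (simp add: z_def)
  qed
  moreover have "f ` third_levels k n \<subseteq> A"
    using f by blast
  ultimately show ?thesis
    by (rule card_inj_on_le) (use A1 finite_subset in auto)
qed

section \<open>Upper bound: a maximal set of the same size\<close>

text \<open>The number of vertices above \<open>x\<close> on its path.\<close>

definition room :: "nat \<Rightarrow> nat \<Rightarrow> nat \<Rightarrow> nat" where
  "room k n x = nat \<lfloor>log (real k) (real n / real x)\<rfloor>"

lemma room_mult_base:
  assumes k: "k \<ge> 2" and x: "x \<ge> 1" and "k * x \<le> n"
  shows "room k n x = Suc (room k n (k * x))"
proof -
  have "real (k * x) \<le> real n" "real (k * x) > 0"
    using assms by (simp_all del: of_nat_mult)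
  then have "log k (real (k * x)) \<le> log k (real n)" and "real n > 0"
    using k by (auto intro: log_mono simp del: of_nat_mult of_nat_0_less_iff)
  moreover have "log k (real (k * x)) = 1 + log k (real x)"
    using k x by (simp add: log_mult)
  moreover have "log k (real n / real x) = log k n - log k x"
    "log k (real n / real (k * x)) = log k n - log k (real (k * x))"
    using k x \<open>real n > 0\<close> by (simp_all add: log_divide del: of_nat_mult)
  \<comment> \<open>Nonnegativity keeps \<open>nat\<close> from truncating, so the added 1 passes
    through floor and \<open>nat\<close>.\<close>
  ultimately have "log k (real n / real (k * x)) \<ge> 0"
    "log k (real n / real x) = 1 + log k (real n / real (k * x))"
    by linarith+
  then show ?thesis
    unfolding room_def by (simp only:) (simp add: nat_add_distrib)
qed

lemma room_eq_0:
  assumes k: "k \<ge> 2" and x: "x \<ge> 1" "x \<le> n" and n: "n < k * x"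
  shows "room k n x = 0"
proof -
  have "real n < real k * real x"
    using n by (metis of_nat_less_iff of_nat_mult)
  then have "real n / real x < real k"
    using x by (simp add: field_simps)
  then have "log k (real n / real x) < 1"
    using k x by simp
  then show ?thesis
    unfolding room_def by simp
qed

lemma ex_maximal_k_free_card_le:
  assumes k: "k \<ge> 2"
  shows "\<exists>A. maximal_k_free k n A \<and> card A \<le> card (third_levels k n)"
proof -
  define v where "v = multiplicity k"
  define w where "w = room k n"
  \<comment> \<open>\<open>v x + w x + 1\<close> is the number of vertices of the path through \<open>x\<close>.\<close>
  define P where "P x \<longleftrightarrow> v x mod 3 = (if (v x + w x) mod 3 = 2 then 1 else 0)" for x
  define A where "A = {x\<in>{1..n}. P x}"
  have v: "v (k * x) = Suc (v x)" if "x \<ge> 1" for x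
    using that k by (simp add: v_def multiplicity_mult_base)
  have w: "w x = Suc (w (k * x))" if "x \<ge> 1" "k * x \<le> n" for x
    using that k by (simp add: w_def room_mult_base)
  have w0: "k * x \<le> n" if "x \<ge> 1" "x \<le> n" "w x \<noteq> 0" for x
    using that room_eq_0[OF k, of x n] unfolding w_def by (meson not_le)
  \<comment> \<open>\<open>v + w\<close> is constant along a path, so both ends of an edge aim at
    the same residue.\<close>
  have P_mult: "P (k * x) \<longleftrightarrow> Suc (v x) mod 3 = (if (v x + w x) mod 3 = 2 then 1 else 0)"
    if "x \<ge> 1" "k * x \<le> n" for x
    using v[of x] w[of x] that by (simp add: P_def)
  have down: "\<exists>y. x = k * y \<and> y \<ge> 1 \<and> y \<le> n" if "x \<ge> 1" "x \<le> n" "v x \<noteq> 0" for x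
  proof -
    have "k dvd x"
      using that by (metis v_def not_dvd_imp_multiplicity_0)
    then obtain y where y: "x = k * y" ..
    moreover have "y \<le> k * y"
      using k by simp
    moreover have "y \<noteq> 0"
      using y that(1) by (intro notI) simp
    ultimately show ?thesis
      using that(2) by (intro exI[of _ y]) linarith
  qed
  have free: "k_free k A"
    unfolding k_free_def
  proof (intro ballI notI)
    fix x y assume "x \<in> A" "y \<in> A" "x = k * y"
    then have "P y" "P (k * y)" "y \<ge> 1" "k * y \<le> n"
      by (auto simp: A_def)
    then have "v y mod 3 = Suc (v y) mod 3"
      using P_mult[of y] by (simp add: P_def)
    then show False
      by presburger
  qed
  have "x \<in> A \<or> k * x \<in> A \<or> (\<exists>y\<in>A. x = k * y)" if "x \<in> {1..n}" for x
  proof -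
    have x: "x \<ge> 1" "x \<le> n" using that by auto
    \<comment> \<open>A height one above the target residue looks down, one below it looks up. The
      bottom has residue 0, hence never needs to look down. At the top, \<open>w x = 0\<close>, so
      residue 2 goes with target 1 and residues 0 and 1 with target 0: the top never needs to look
      up. This is why the paths of length divisible by 3 are shifted.\<close>
    consider "P x"
      | "w x \<noteq> 0" "Suc (v x) mod 3 = (if (v x + w x) mod 3 = 2 then 1 else 0)"
      | "v x \<noteq> 0" "v x mod 3 = Suc (if (v x + w x) mod 3 = 2 then 1 else 0)"
    proof -
      have "v x mod 3 = 0 \<or> v x mod 3 = 1 \<or> v x mod 3 = 2"
        by presburger
      moreover have "w x = 0 \<Longrightarrow> (v x + w x) mod 3 = v x mod 3"
        by simp
      moreover have "v x mod 3 = 2 \<Longrightarrow> Suc (v x) mod 3 = 0" "v x mod 3 = 0 \<Longrightarrow> Suc (v x) mod 3 = 1"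
        by presburger+
      moreover have "v x = 0 \<Longrightarrow> v x mod 3 = 0"
        by simp
      ultimately show thesis
        using that unfolding P_def
        by (smt (verit, ccfv_SIG) One_nat_def Suc_1 numeral_eq_iff one_neq_zero zero_neq_numeral)
    qed
    then show ?thesis
    proof cases
      case 1
      then show ?thesis using x by (simp add: A_def)
    next
      case 2
      then show ?thesis using x w0[of x] P_mult[of x] k by (simp add: A_def)
    next
      case 3
      then obtain y where y: "x = k * y" "y \<ge> 1" "y \<le> n"
        using down x by blast
      have "Suc (v y) mod 3 = Suc (if (v y + w y) mod 3 = 2 then 1 else 0)"
        using 3 y x v[of y] w[of y] by simp
      then have "P y"
        unfolding P_def by (cases "(v y + w y) mod 3 = 2") (simp; presburger)+
      then show ?thesis
        using y by (auto simp: A_def)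
    qed
  qed
  then have max: "maximal_k_free k n A"
    using free unfolding maximal_k_free_iff_dominating[OF k] by (auto simp: A_def)
  \<comment> \<open>\<open>g\<close> undoes the shift, moving heights of residue 1 down one
    step.\<close>
  define g where "g x = (if 3 dvd v x then x else x div k)" for x
  have g: "3 dvd v x \<and> g x = x \<or> (x = k * g x \<and> g x \<in> third_levels k n)" if xA: "x \<in> A" for x
  proof (cases "3 dvd v x")
    case False
    then have "v x mod 3 = 1" "v x \<noteq> 0"
      using xA by (auto simp: A_def P_def split: if_splits)
    moreover obtain y where y: "x = k * y" "y \<ge> 1" "y \<le> n"
      using down[OF _ _ \<open>v x \<noteq> 0\<close>] xA by (auto simp: A_def)
    ultimately have "Suc (v y) mod 3 = 1"
      using v by simp
    then have "3 dvd v y"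
      by presburger
    then show ?thesis
      using False y k by (simp add: g_def third_levels_def v_def)
  qed (simp add: g_def)
  have "inj_on g A"
  proof (rule inj_onI)
    fix x y assume xy: "x \<in> A" "y \<in> A" "g x = g y"
    \<comment> \<open>If only one of the two were moved, they would be joined by an edge inside
      \<open>A\<close>.\<close>
    then show "x = y"
      using g[of x] g[of y] free unfolding k_free_def by metis
  qed
  moreover have "g ` A \<subseteq> third_levels k n"
  proof
    fix z assume "z \<in> g ` A"
    then obtain x where "x \<in> A" "z = g x" by blast
    then show "z \<in> third_levels k n"
      using g[of x] by (auto simp: third_levels_def A_def v_def)
  qed
  ultimately have "card A \<le> card (third_levels k n)"
    by (rule card_inj_on_le) simp
  then show ?thesis
    using max by blast
qed

theorem R_tilde_eq_card_third_levels:
  assumes "k \<ge> 2"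
  shows "R_tilde k n = card (third_levels k n)"
proof -
  obtain A where A: "maximal_k_free k n A" "card A \<le> card (third_levels k n)"
    using ex_maximal_k_free_card_le[OF assms] by blast
  then have "card A = card (third_levels k n)"
    using card_third_levels_le[OF assms] by (simp add: le_antisym)
  then show ?thesis
    unfolding R_tilde_def using A card_third_levels_le[OF assms]
    by (intro Min_eqI) (auto simp: finite_maximal_k_free intro!: rev_image_eqI)
qed

section \<open>Recursion for the count\<close>

lemma card_multiples:
  fixes k :: nat
  assumes "k \<ge> 1"
  shows "card {x\<in>{1..n}. k dvd x} = n div k"
proof -
  have "{x\<in>{1..n}. k dvd x} = (\<lambda>y. k * y) ` {1..n div k}"
    using assms by (auto simp: less_eq_div_iff_mult_less_eq mult.commute Suc_le_eq elim!: dvdE)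
  moreover have "inj_on (\<lambda>y. k * y) {1..n div k}"
    using assms by (simp add: inj_on_def)
  ultimately show ?thesis
    by (simp add: card_image)
qed

text \<open>Height 0 means not divisible by \<open>k\<close>; the other heights divisible by 3 are
  at least 3, and dividing by \<open>k ^ 3\<close> lowers them by 3. The subtracted term stands on
  the left to avoid truncated subtraction.\<close>

lemma card_third_levels_rec:
  assumes k: "k \<ge> 2"
  shows "card (third_levels k n) + n div k = n + card (third_levels k (n div k ^ 3))"
proof -
  let ?D = "{x\<in>{1..n}. k dvd x}" and ?S = "third_levels k (n div k ^ 3)"
  have v3: "multiplicity k (k ^ 3 * y) = multiplicity k y + 3" if "y \<ge> 1" for y
    using that k multiplicity_mult_base[of k y] multiplicity_mult_base[of k "k * y"]
      multiplicity_mult_base[of k "k * (k * y)"]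
    by (simp add: power3_eq_cube mult.assoc)
  have k3: "k ^ 3 > 0" using k by simp
  have "third_levels k n = ({1..n} - ?D) \<union> (\<lambda>y. k ^ 3 * y) ` ?S"
  proof (intro equalityI subsetI)
    fix x assume x: "x \<in> third_levels k n"
    show "x \<in> ({1..n} - ?D) \<union> (\<lambda>y. k ^ 3 * y) ` ?S"
    proof (cases "k dvd x")
      case True
      then have "multiplicity k x \<noteq> 0"
        using x k by (subst multiplicity_eq_zero_iff) (auto simp: third_levels_def)
      then have "multiplicity k x \<ge> 3"
        using x by (auto simp: third_levels_def elim!: dvdE)
      then obtain y where y: "x = k ^ 3 * y"
        using multiplicity_dvd' by (metis dvdE)
      then have "y \<ge> 1" "y \<le> n div k ^ 3"
        using x k3 by (auto simp: third_levels_def less_eq_div_iff_mult_less_eq mult.commute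
            Suc_le_eq intro: Nat.gr0I)
      moreover from this have "3 dvd multiplicity k y"
        using x v3[of y] unfolding y third_levels_def by simp
      ultimately show ?thesis
        using y by (auto simp: third_levels_def)
    qed (use x in \<open>auto simp: third_levels_def\<close>)
  next
    fix x assume "x \<in> ({1..n} - ?D) \<union> (\<lambda>y. k ^ 3 * y) ` ?S"
    then show "x \<in> third_levels k n"
      using k3 k v3
      by (auto simp: third_levels_def not_dvd_imp_multiplicity_0 less_eq_div_iff_mult_less_eq
          mult.commute Suc_le_eq)
  qed
  moreover have "({1..n} - ?D) \<inter> (\<lambda>y. k ^ 3 * y) ` ?S = {}"
    using k3 by (auto simp: third_levels_def less_eq_div_iff_mult_less_eq mult.commute
        power3_eq_cube Suc_le_eq)
  moreover have "card ((\<lambda>y. k ^ 3 * y) ` ?S) = card ?S"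
    using k3 by (intro card_image) (simp add: inj_on_def)
  ultimately have "card (third_levels k n) = card ({1..n} - ?D) + card ?S"
    by (simp add: card_Un_disjoint)
  moreover have "card ({1..n} - ?D) = n - n div k"
    using card_multiples[of k n] k by (subst card_Diff_subset) auto
  ultimately show ?thesis
    using div_le_dividend[of n k] by linarith
qed

section \<open>Solving the recursion up to rounding\<close>

lemma of_nat_div_le: "real (n div d) \<le> real n / real d"
  by (metis floor_divide_of_nat_eq of_int_floor_le of_int_of_nat_eq)

lemma abs_of_nat_div_diff_le: "\<bar>real (n div d) - real n / real d\<bar> \<le> 1"
proof -
  have "real_of_int \<lfloor>real n / real d\<rfloor> = real (n div d)"
    by (simp only: floor_divide_of_nat_eq of_int_of_nat_eq)
  then show ?thesis
    by linarith
qed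

lemma card_third_levels_asymp:
  fixes k n :: nat
  assumes k: "k \<ge> 2" and "n \<ge> 1"
  shows "\<bar>real (card (third_levels k n)) - (real k)\<^sup>2 / ((real k)\<^sup>2 + real k + 1) * real n\<bar>
    \<le> 2 + 2 * log k n"
  using \<open>n \<ge> 1\<close>
proof (induction n rule: less_induct)
  case (less n)
  define c where "c = (real k)\<^sup>2 / ((real k)\<^sup>2 + real k + 1)"
  define s where "s m = real (card (third_levels k m))" for m
  have kpos: "(real k)\<^sup>2 + real k + 1 > 0"
    by (simp add: add_nonneg_pos)
  have c: "0 \<le> c" "c \<le> 1"
    using kpos by (auto simp: c_def field_simps)
  \<comment> \<open>This fixed-point equation makes the unrounded terms cancel, leaving two rounding
    errors of at most 1 each.\<close>
  have c_eq: "c = 1 - 1 / k + c / k ^ 3"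
    using kpos k unfolding c_def
    by (simp add: divide_simps) (simp add: algebra_simps power2_eq_square power3_eq_cube)
  let ?m = "n div k ^ 3"
  have rec: "s n = real n - real (n div k) + s ?m"
    using card_third_levels_rec[OF k, of n] unfolding s_def by linarith
  have "c * real n = real n - real n / k + c * (real n / k ^ 3)"
    using arg_cong[OF c_eq, of "\<lambda>t. t * real n"] by (simp add: algebra_simps)
  then have "s n - c * n =
      (s ?m - c * ?m) - (real (n div k) - real n / k) + c * (real ?m - real n / real (k ^ 3))"
    using rec by (simp add: algebra_simps)
  moreover have "\<bar>real (n div k) - real n / k\<bar> \<le> 1"
    by (rule abs_of_nat_div_diff_le)
  moreover have "\<bar>c * (real ?m - real n / real (k ^ 3))\<bar> \<le> 1 * 1"
    unfolding abs_mult using c by (intro mult_mono abs_of_nat_div_diff_le) auto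
  ultimately have step: "\<bar>s n - c * n\<bar> \<le> \<bar>s ?m - c * ?m\<bar> + 2"
    by linarith
  have "\<bar>s n - c * n\<bar> \<le> 2 + 2 * log k n"
  proof (cases "?m = 0")
    case True
    then have "s ?m - c * ?m = 0"
      by (simp add: s_def third_levels_def)
    moreover have "log k n \<ge> 0"
      using k less.prems by simp
    ultimately show ?thesis
      using step by simp
  next
    case False
    have "?m < n"
      using k less.prems by (intro div_less_dividend one_less_power) auto
    then have "\<bar>s ?m - c * ?m\<bar> \<le> 2 + 2 * log k ?m"
      using less.IH[of ?m] False by (simp add: s_def c_def)
    moreover have "log k ?m \<le> log k (real n / real k ^ 3)"
      using False k of_nat_div_le[of n "k ^ 3"] by (intro log_mono) auto
    \<comment> \<open>The drop by 3 lowers the inductive bound by 6, which outweighs the 2 added by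
      the step.\<close>
    moreover have "log k (real n / real k ^ 3) = log k n - 3"
      using k less.prems by (simp add: log_divide log_nat_power)
    ultimately show ?thesis
      using step by linarith
  qed
  then show ?case
    by (simp add: s_def c_def)
qed

theorem theorem6:
  fixes k :: nat
  assumes "k \<ge> 2"
  shows "(\<lambda>n::nat. real (R_tilde k n) - (real k)\<^sup>2 / ((real k)\<^sup>2 + real k + 1) * real n)
           \<in> O(\<lambda>n. (log (real k) (real n))\<^sup>2)"
proof (rule bigoI[where c = 4], rule eventually_sequentiallyI)
  fix n :: nat
  assume n: "n \<ge> k"
  have "log k n \<ge> 1"
    using n assms by simp
  \<comment> \<open>The constant 4 comes from \<open>2 + 2 * l \<le> 4 * l\<close> and
    \<open>l \<le> l ^ 2\<close>, both valid once \<open>n \<ge> k\<close> gives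
    \<open>l \<ge> 1\<close>.\<close>
  moreover have "2 + 2 * l \<le> 4 * l\<^sup>2" if "l \<ge> 1" for l :: real
    using self_le_power[OF that, of 2] that by simp
  ultimately have "2 + 2 * log k n \<le> 4 * (log k n)\<^sup>2"
    by blast
  moreover have "n \<ge> 1"
    using n assms by simp
  ultimately show "norm (real (R_tilde k n) - (real k)\<^sup>2 / ((real k)\<^sup>2 + real k + 1) * real n)
      \<le> 4 * norm ((log (real k) (real n))\<^sup>2)"
    using card_third_levels_asymp[OF assms, of n] R_tilde_eq_card_third_levels[OF assms, of n]
    by simp
qed

end
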